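(* Let $F=f+g$ satisfy Assumption 1 (i) and (ii) given in the context, and let $(x_k)_{k\ge 0}$ be a sequence generated by the RCCM algorithm described in the context with regularization parameters $M_i>0$ for all $i=1,\dots,N$. Assume that the sequence $(x_k)_{k\geq 0}$ is bounded. Then there exists a constant $C>0$, independent of $k$, with $\min_{s_{k+1}\in\partial F(x_{k+1})}\|s_{k+1}\|\le C\|x_{k+1}-x_k\|$ for all $k\ge 0$, and for this $C$ the following convergence rate holds for every integer $K\ge 0$: $$\min_{k=0,\dots,K}\ \min_{s_{k+1}\in\partial F(x_{k+1})}\|s_{k+1}\|^2\ \le\ \frac{2C^2\,(F(x_0)-F^* )}{M_{\min}\,(K+1)}.$$
   Context: Blocks. Let $n=\sum_{i=1}^N n_i$, let $E=[E_1,\dots,E_N]$ be a column permutation of the $n\times n$ identity matrix partitioned into $E_i\in\mathbb{R}^{n\times n_i}$; for $x\in\mathbb{R}^n$ put $x^{(i)}=E_i^Tx\in\mathbb{R}^{n_i}$, so $x=\sum_i E_i x^{(i)}$, also written $x=(x^{(1)},\dots,x^{(N)})$. $\|\cdot\|$ is the Euclidean norm. $\partial F$ is the limiting subdifferential. Problem. $F^*=\min_{x\in\mathbb{R}^n}F(x)$, $F(x):=f(x)+g(x)$, with $f:\mathbb{R}^n\to\mathbb{R}$ and $g:\mathbb{R}^n\to(-\infty,+\infty]$, both possibly nonconvex. Assumption 1. (i) $f$ is twice continuously differentiable; $g$ is proper, lower semicontinuous and separable, $g(x)=\sum_{i=1}^N g_i(x^{(i)})$; and for every $i$ and every fixed $\hat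 y=(y^{(1)},\dots,y^{(i-1)},y^{(i+1)},\dots,y^{(N)})$ one has $\inf_{x^{(i)}\in\mathbb{R}^{n_i}} f(x^{(i)},\hat y)+g_i(x^{(i)})>-\infty$, where $f(x^{(i)},\hat y)$ is the value of $f$ at the vector whose $i$-th block is $x^{(i)}$ and whose other blocks are those of $\hat y$. (ii) The problem has a solution (hence $F^*>-\infty$). RCCM (Regularized Cyclic Coordinate Minimization) algorithm. Given regularization parameters $M_i\ge 0$, $i=1,\dots,N$, and $x_0\in\mathrm{dom}\,g$, for $k=0,1,2,\dots$ and, within each $k$, successively for $i=1,\dots,N$, choose $$x_{k+1}^{(i)}\in\arg\min_{x^{(i)}\in\mathbb{R}^{n_i}} f(x^{(i)},\hat x_{k,i})+g_i(x^{(i)})+\frac{M_i}{2}\|x^{(i)}-x_k^{(i)}\|^2,$$ where $\hat x_{k,i}=(x_{k+1}^{(1)},\dots,x_{k+1}^{(i-1)},x_k^{(i+1)},\dots,x_k^{(N)})$; then set $x_{k+1}=(x_{k+1}^{(1)},\dots,x_{k+1}^{(N)})$. $M_{\min}=\min(M_1,\dots,M_N)$. *)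

theory Defs
  imports "HOL-Analysis.Analysis"
begin

definition proper_fun :: "('a \<Rightarrow> ereal) \<Rightarrow> bool" where
  "proper_fun g \<longleftrightarrow> (\<forall>x. g x \<noteq> -\<infinity>) \<and> (\<exists>x. g x \<noteq> \<infinity>)"

definition effective_domain :: "('a \<Rightarrow> ereal) \<Rightarrow> 'a set" where
  "effective_domain g = {x. g x < \<infinity>}"

definition lsc_fun :: "('a::topological_space \<Rightarrow> ereal) \<Rightarrow> bool" where
  "lsc_fun g \<longleftrightarrow> (\<forall>x. g x \<le> Liminf (at x) g)"

definition twice_continuously_differentiable ::
    "('a::real_normed_vector \<Rightarrow> real) \<Rightarrow> bool" where
  "twice_continuously_differentiable f \<longleftrightarrow>
     (\<exists>(f' :: 'a \<Rightarrow> 'a \<Rightarrow>\<^sub>L real) (f'' :: 'a \<Rightarrow> 'a \<Rightarrow>\<^sub>L ('a \<Rightarrow>\<^sub>L real)).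
        (\<forall>x. (f has_derivative blinfun_apply (f' x)) (at x)) \<and>
        (\<forall>x. (f' has_derivative blinfun_apply (f'' x)) (at x)) \<and>
        continuous_on UNIV f'')"

text \<open>
  Both subdifferentials are empty at points where \<open>F\<close> is infinite, so the \<^typ>\<open>ereal\<close>
  differences and the division below never meet an indeterminate form.
\<close>

definition frechet_subdiff :: "('a::real_inner \<Rightarrow> ereal) \<Rightarrow> 'a \<Rightarrow> 'a set" where
  "frechet_subdiff F x =
     {s. \<bar>F x\<bar> \<noteq> \<infinity> \<and>
         0 \<le> Liminf (at x)
               (\<lambda>y. (F y - F x - ereal (s \<bullet> (y - x))) / ereal (norm (y - x)))}"

definition limiting_subdiff :: "('a::real_inner \<Rightarrow> ereal) \<Rightarrow> 'a \<Rightarrow> 'a set" where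
  "limiting_subdiff F x =
     {s. \<bar>F x\<bar> \<noteq> \<infinity> \<and>
         (\<exists>u v. u \<longlonglongrightarrow> x \<and> (\<lambda>k. F (u k)) \<longlonglongrightarrow> F x \<and>
                (\<forall>k. v k \<in> frechet_subdiff F (u k)) \<and> v \<longlonglongrightarrow> s)}"

text \<open>
  A vector of \<open>\<real>\<^sup>m\<close>, for \<open>m\<close> a natural number, is a function \<open>z :: nat \<Rightarrow> real\<close> with
  \<open>z l = 0\<close> for \<open>l \<ge> m\<close>, as in the library's \<^const>\<open>Euclidean_space\<close>.
\<close>

abbreviation Rpow :: "nat \<Rightarrow> (nat \<Rightarrow> real) set" where
  "Rpow m \<equiv> topspace (Euclidean_space m)"

abbreviation Rnorm :: "nat \<Rightarrow> (nat \<Rightarrow> real) \<Rightarrow> real" where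
  "Rnorm m z \<equiv> L2_set z {..<m}"

text \<open>
  \<open>E i l\<close> is column \<open>l\<close> (counted from \<open>0\<close>) of the matrix \<open>E\<^sub>i\<close>, for \<open>i \<in> {1..N}\<close> and
  \<open>l < n i\<close>. That the columns of \<open>[E\<^sub>1, \<dots>, E\<^sub>N]\<close> are those of the identity matrix, in some
  order, entails \<open>CARD('d) = (\<Sum>i = 1..N. n i)\<close>.
\<close>

definition block_partition ::
    "nat \<Rightarrow> (nat \<Rightarrow> nat) \<Rightarrow> (nat \<Rightarrow> nat \<Rightarrow> real ^ 'd) \<Rightarrow> bool" where
  "block_partition N n E \<longleftrightarrow>
     bij_betw (\<lambda>(i, l). E i l) (SIGMA i:{1..N}. {..<n i}) (range (\<lambda>j. axis j 1))"

text \<open>\<open>block n E x i\<close> is \<open>E\<^sub>i\<^sup>T x\<close>, and \<open>assemble N n E y\<close> is \<open>\<Sum>\<^sub>i E\<^sub>i y\<^sub>i\<close>.\<close>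

definition block ::
    "(nat \<Rightarrow> nat) \<Rightarrow> (nat \<Rightarrow> nat \<Rightarrow> real ^ 'd) \<Rightarrow> real ^ 'd \<Rightarrow> nat \<Rightarrow> (nat \<Rightarrow> real)" where
  "block n E x i = (\<lambda>l. if l < n i then E i l \<bullet> x else 0)"

definition assemble ::
    "nat \<Rightarrow> (nat \<Rightarrow> nat) \<Rightarrow> (nat \<Rightarrow> nat \<Rightarrow> real ^ 'd) \<Rightarrow> (nat \<Rightarrow> nat \<Rightarrow> real) \<Rightarrow> real ^ 'd"
  where
  "assemble N n E y = (\<Sum>i = 1..N. \<Sum>l<n i. y i l *\<^sub>R E i l)"

definition separable ::
    "nat \<Rightarrow> (nat \<Rightarrow> nat) \<Rightarrow> (nat \<Rightarrow> nat \<Rightarrow> real ^ 'd) \<Rightarrow> (real ^ 'd \<Rightarrow> ereal) \<Rightarrow>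
     (nat \<Rightarrow> (nat \<Rightarrow> real) \<Rightarrow> ereal) \<Rightarrow> bool" where
  "separable N n E g gi \<longleftrightarrow>
     (\<forall>i\<in>{1..N}. \<forall>z\<in>Rpow (n i). gi i z \<noteq> -\<infinity>) \<and>
     (\<forall>x. g x = (\<Sum>i = 1..N. gi i (block n E x i)))"

text \<open>Only the blocks of \<open>y\<close> other than the \<open>i\<close>-th matter below.\<close>

definition block_problems_bounded_below ::
    "nat \<Rightarrow> (nat \<Rightarrow> nat) \<Rightarrow> (nat \<Rightarrow> nat \<Rightarrow> real ^ 'd) \<Rightarrow> (real ^ 'd \<Rightarrow> real) \<Rightarrow>
     (nat \<Rightarrow> (nat \<Rightarrow> real) \<Rightarrow> ereal) \<Rightarrow> bool" where
  "block_problems_bounded_below N n E f gi \<longleftrightarrow>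
     (\<forall>i\<in>{1..N}. \<forall>y.
        (INF z\<in>Rpow (n i). ereal (f (assemble N n E ((block n E y)(i := z)))) + gi i z)
          > -\<infinity>)"

text \<open>
  The objective of the \<open>i\<close>-th block problem within a sweep from \<open>x\<close> to \<open>x'\<close>: the blocks
  before the \<open>i\<close>-th are the new ones, the blocks after it the old ones.
\<close>

definition rccm_objective ::
    "nat \<Rightarrow> (nat \<Rightarrow> nat) \<Rightarrow> (nat \<Rightarrow> nat \<Rightarrow> real ^ 'd) \<Rightarrow> (real ^ 'd \<Rightarrow> real) \<Rightarrow>
     (nat \<Rightarrow> (nat \<Rightarrow> real) \<Rightarrow> ereal) \<Rightarrow> (nat \<Rightarrow> real) \<Rightarrow>
     real ^ 'd \<Rightarrow> real ^ 'd \<Rightarrow> nat \<Rightarrow> (nat \<Rightarrow> real) \<Rightarrow> ereal" where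
  "rccm_objective N n E f gi M x x' i z =
     ereal (f (assemble N n E
       (\<lambda>j. if j < i then block n E x' j else if j = i then z else block n E x j)))
     + gi i z
     + ereal (M i / 2 * (Rnorm (n i) (\<lambda>l. z l - block n E x i l))\<^sup>2)"

definition rccm_sequence ::
    "nat \<Rightarrow> (nat \<Rightarrow> nat) \<Rightarrow> (nat \<Rightarrow> nat \<Rightarrow> real ^ 'd) \<Rightarrow> (real ^ 'd \<Rightarrow> real) \<Rightarrow>
     (real ^ 'd \<Rightarrow> ereal) \<Rightarrow> (nat \<Rightarrow> (nat \<Rightarrow> real) \<Rightarrow> ereal) \<Rightarrow> (nat \<Rightarrow> real) \<Rightarrow>
     (nat \<Rightarrow> real ^ 'd) \<Rightarrow> bool" where
  "rccm_sequence N n E f g gi M x \<longleftrightarrow>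
     x 0 \<in> effective_domain g \<and>
     (\<forall>k. \<forall>i\<in>{1..N}.
        is_arg_min (rccm_objective N n E f gi M (x k) (x (Suc k)) i)
          (\<lambda>z. z \<in> Rpow (n i)) (block n E (x (Suc k)) i))"

end

theory Submission
  imports Defs
begin

text \<open>Everything follows from block optimality. Let \<open>w i\<close> be the point reached
  after i block updates of the sweep from x to x'. By the i-th update, f plus \<open>gi i\<close>
  plus the proximal term, varied in block i around \<open>w i\<close>, is smallest at the block of
  x' (\<open>block_le\<close>).

  Compared with the old block and summed over i, the values of f telescope, and F drops by at least
  M_min/2 times the squared step |x' - x|^2 (\<open>sufficient_decrease\<close>).

  Compared with an arbitrary block, the same inequality bounds \<open>gi i\<close> below by a smooth
  function touching it at x'. With f added, F gets a smooth minorant touching it at x', whose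
  gradient there is a Frechet and hence a limiting subgradient (\<open>small_subgradient\<close>).
  Block i of this gradient is that of grad f(x') - grad f(\<open>w i\<close>), minus M_i times that
  of x' - x. Since the sequence is bounded, all these points lie in one ball, on which grad f is
  Lipschitz; hence the bound C |x' - x|.

  Squaring this bound and summing the decrease over k = 0..K gives the rate. The minimal norm is
  attained because limiting subdifferentials are closed.\<close>

declare One_nat_def [simp del]

section \<open>Frechet and limiting subdifferentials\<close>

text \<open>The difference quotient of \<open>F\<close> dominates that of the touching function
  \<open>\<phi>\<close>, which tends to 0 by differentiability.\<close>

lemma frechet_subdiff_of_minorant:
  fixes F :: "'a::{real_inner, perfect_space} \<Rightarrow> ereal"
  assumes fin: "\<bar>F x\<bar> \<noteq> \<infinity>"
    and der: "(\<phi> has_derivative (\<lambda>h. s \<bullet> h)) (at x)"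
    and minorant: "\<And>y. F x + ereal (\<phi> y - \<phi> x) \<le> F y"
  shows "s \<in> frechet_subdiff F x"
proof -
  let ?q = "\<lambda>y. (\<phi> y - \<phi> x - s \<bullet> (y - x)) / norm (y - x)"
  have "(?q \<longlongrightarrow> 0) (at x)"
    using der by (simp add: has_derivative_within diff_diff_eq)
  hence "((\<lambda>y. ereal (?q y)) \<longlongrightarrow> ereal 0) (at x)"
    by (rule tendsto_ereal)
  hence "Liminf (at x) (\<lambda>y. ereal (?q y)) = 0"
    by (simp add: lim_imp_Liminf zero_ereal_def)
  moreover have "Liminf (at x) (\<lambda>y. ereal (?q y)) \<le> Liminf (at x)
               (\<lambda>y. (F y - F x - ereal (s \<bullet> (y - x))) / ereal (norm (y - x)))"
  proof (rule Liminf_mono)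
    have "ereal (?q y) \<le> (F y - F x - ereal (s \<bullet> (y - x))) / ereal (norm (y - x))"
      if "y \<noteq> x" for y
    proof -
      have "ereal (\<phi> y - \<phi> x) - ereal (s \<bullet> (y - x)) \<le> F y - F x - ereal (s \<bullet> (y - x))"
        using minorant[of y] fin by (cases "F y"; cases "F x") auto
      hence "ereal (\<phi> y - \<phi> x - s \<bullet> (y - x)) / ereal (norm (y - x))
          \<le> (F y - F x - ereal (s \<bullet> (y - x))) / ereal (norm (y - x))"
        using that by (intro ereal_divide_right_mono) auto
      thus ?thesis using that by simp
    qed
    thus "\<forall>\<^sub>F y in at x. ereal (?q y) \<le> (F y - F x - ereal (s \<bullet> (y - x))) / ereal (norm (y - x))"
      by (auto simp: eventually_at_filter)
  qed
  ultimately show ?thesis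
    using fin by (simp add: frechet_subdiff_def)
qed

lemma frechet_subdiff_subset_limiting: "frechet_subdiff F x \<subseteq> limiting_subdiff F x"
proof
  fix s assume s: "s \<in> frechet_subdiff F x"
  hence "\<bar>F x\<bar> \<noteq> \<infinity>" by (simp add: frechet_subdiff_def)
  with s show "s \<in> limiting_subdiff F x"
    unfolding limiting_subdiff_def
    by (intro CollectI conjI exI[of _ "\<lambda>_. x"] exI[of _ "\<lambda>_. s"]) auto
qed

text \<open>The limiting subdifferential is a slice of the closure of the graph of the Frechet one.\<close>

lemma closed_limiting_subdiff:
  fixes F :: "'a::real_inner \<Rightarrow> ereal"
  shows "closed (limiting_subdiff F x)"
proof (cases "\<bar>F x\<bar> = \<infinity>")
  case True
  thus ?thesis by (simp add: limiting_subdiff_def)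
next
  case False
  \<comment> \<open>Recording the value of \<open>F\<close> as a real coordinate turns convergence
    of the values \<open>F (u k)\<close> into ordinary convergence in a product space. A point with
    a Frechet subgradient has a finite value, so no information is lost.\<close>
  define G where "G = {(u, real_of_ereal (F u), v) |u v. v \<in> frechet_subdiff F u}"
  have conv: "(\<lambda>k. F (u k)) \<longlonglongrightarrow> F x \<longleftrightarrow>
      (\<lambda>k. real_of_ereal (F (u k))) \<longlonglongrightarrow> real_of_ereal (F x)"
    if "\<forall>k. v k \<in> frechet_subdiff F (u k)" for u v
  proof -
    have "(\<lambda>k. F (u k)) = (\<lambda>k. ereal (real_of_ereal (F (u k))))"
      using that by (auto simp: frechet_subdiff_def ereal_real)
    moreover have "F x = ereal (real_of_ereal (F x))"
      using False by (simp add: ereal_real)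
    ultimately show ?thesis by (metis lim_ereal)
  qed
  have "limiting_subdiff F x = (\<lambda>s. (x, real_of_ereal (F x), s)) -` closure G"
  proof (intro set_eqI iffI)
    fix s assume "s \<in> limiting_subdiff F x"
    then obtain u v where uv: "u \<longlonglongrightarrow> x" "(\<lambda>k. F (u k)) \<longlonglongrightarrow> F x"
        "\<forall>k. v k \<in> frechet_subdiff F (u k)" "v \<longlonglongrightarrow> s"
      by (auto simp: limiting_subdiff_def)
    hence "(\<lambda>k. (u k, real_of_ereal (F (u k)), v k)) \<longlonglongrightarrow> (x, real_of_ereal (F x), s)"
      using conv by (intro tendsto_Pair) auto
    moreover have "\<forall>k. (u k, real_of_ereal (F (u k)), v k) \<in> G"
      using uv by (auto simp: G_def)
    ultimately show "s \<in> (\<lambda>s. (x, real_of_ereal (F x), s)) -` closure G"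
      unfolding vimage_eq closure_sequential
      by (intro exI[of _ "\<lambda>k. (u k, real_of_ereal (F (u k)), v k)"] conjI)
  next
    fix s assume "s \<in> (\<lambda>s. (x, real_of_ereal (F x), s)) -` closure G"
    then obtain p where p: "\<forall>k. p k \<in> G" "p \<longlonglongrightarrow> (x, real_of_ereal (F x), s)"
      unfolding vimage_eq closure_sequential by blast
    define u v where "u k = fst (p k)" and "v k = snd (snd (p k))" for k
    have "v k \<in> frechet_subdiff F (u k) \<and> fst (snd (p k)) = real_of_ereal (F (u k))" for k
      using p(1)[rule_format, of k] by (auto simp: G_def u_def v_def)
    hence v: "\<forall>k. v k \<in> frechet_subdiff F (u k)" and "\<And>k. fst (snd (p k)) = real_of_ereal (F (u k))"
      by blast+
    moreover have "u \<longlonglongrightarrow> x" "(\<lambda>k. fst (snd (p k))) \<longlonglongrightarrow> real_of_ereal (F x)" "v \<longlonglongrightarrow> s"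
      using tendsto_fst[OF p(2)] tendsto_fst[OF tendsto_snd[OF p(2)]]
        tendsto_snd[OF tendsto_snd[OF p(2)]] by (auto simp: u_def[abs_def] v_def[abs_def])
    ultimately show "s \<in> limiting_subdiff F x"
      using False conv[OF v] unfolding limiting_subdiff_def by auto
  qed
  thus ?thesis
    by (auto intro!: closed_vimage continuous_intros)
qed

text \<open>A nonempty closed subset of a Euclidean space has a point nearest to the origin. This
  justifies speaking of a minimum over subgradients.\<close>

lemma limiting_subdiff_minimal_norm:
  fixes F :: "'a::euclidean_space \<Rightarrow> ereal"
  assumes "limiting_subdiff F x \<noteq> {}"
  shows "\<exists>s. is_arg_min norm (\<lambda>s. s \<in> limiting_subdiff F x) s"
proof -
  obtain s where "s \<in> limiting_subdiff F x" "\<And>t. t \<in> limiting_subdiff F x \<Longrightarrow> dist 0 s \<le> dist 0 t"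
    using distance_attains_inf[OF closed_limiting_subdiff assms] by blast
  thus ?thesis by (auto simp: is_arg_min_linorder)
qed

section \<open>Gradients and Lipschitz bounds\<close>

text \<open>Turns a derivative, given as a functional, into a gradient vector. The norm bound comes
  from evaluating the functional at the vector itself.\<close>

lemma riesz_euclidean:
  fixes A :: "'a::euclidean_space \<Rightarrow>\<^sub>L real"
  obtains s where "\<And>h. blinfun_apply A h = s \<bullet> h" "norm s \<le> norm A"
proof -
  define s where "s = (\<Sum>b\<in>Basis. blinfun_apply A b *\<^sub>R b)"
  have A: "blinfun_apply A h = s \<bullet> h" for h
  proof -
    have "blinfun_apply A h = blinfun_apply A (\<Sum>b\<in>Basis. (h \<bullet> b) *\<^sub>R b)"
      by (simp add: euclidean_representation)
    also have "\<dots> = s \<bullet> h"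
      unfolding s_def inner_sum_left blinfun.sum_right blinfun.scaleR_right
      by (simp add: inner_commute mult.commute)
    finally show ?thesis .
  qed
  have "norm s * norm s \<le> norm A * norm s"
    using norm_blinfun[of A s] by (simp add: A dot_square_norm power2_eq_square)
  hence "norm s \<le> norm A"
    by (cases "s = 0") auto
  with A that show thesis by blast
qed

text \<open>The second derivative is bounded on the compact ball, and the ball is convex, so the
  mean value inequality applies.\<close>

lemma C2_derivative_lipschitz_on_cball:
  fixes f' :: "'a::euclidean_space \<Rightarrow> 'b::real_normed_vector"
  assumes "\<And>x. (f' has_derivative blinfun_apply (f'' x)) (at x)"
    and "continuous_on UNIV f''"
  obtains L where "L \<ge> 0"
    "\<And>u v. \<lbrakk>norm u \<le> R; norm v \<le> R\<rbrakk> \<Longrightarrow> norm (f' u - f' v) \<le> L * norm (u - v)"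
proof -
  have "bounded (f'' ` cball 0 R)"
    by (intro compact_imp_bounded compact_continuous_image)
      (auto intro: continuous_on_subset[OF assms(2)])
  then obtain L where L: "L > 0" "\<And>u. u \<in> cball 0 R \<Longrightarrow> norm (f'' u) \<le> L"
    by (auto simp: bounded_pos)
  have "norm (f' u - f' v) \<le> L * norm (u - v)" if "norm u \<le> R" "norm v \<le> R" for u v
    using that L(2)
    by (intro differentiable_bound[of "cball 0 R" f' "\<lambda>x. blinfun_apply (f'' x)"])
      (auto simp: norm_blinfun.rep_eq[symmetric] intro: has_derivative_at_withinI assms(1))
  with L that show thesis by (meson less_imp_le)
qed

subsection \<open>Block projections\<close>

text \<open>The matrix E_i E_i^T, which under \<open>block_partition\<close> is the orthogonal
  projector onto the coordinates of block i. It lets block problems be handled inside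
  \<open>real ^ 'd\<close> instead of \<open>Rpow (n i)\<close>.\<close>

definition block_proj ::
    "(nat \<Rightarrow> nat) \<Rightarrow> (nat \<Rightarrow> nat \<Rightarrow> real ^ 'd) \<Rightarrow> nat \<Rightarrow> real ^ 'd \<Rightarrow> real ^ 'd" where
  "block_proj n E i x = (\<Sum>l<n i. (E i l \<bullet> x) *\<^sub>R E i l)"

lemma assemble_block:
  "assemble N n E (\<lambda>i. block n E (v i) i) = (\<Sum>i = 1..N. block_proj n E i (v i))"
  by (simp add: assemble_def block_proj_def block_def)

lemma block_mem_Rpow: "block n E x i \<in> Rpow (n i)"
  by (simp add: block_def topspace_Euclidean_space)

lemma bounded_linear_block_proj: "bounded_linear (block_proj n E i)"
  unfolding block_proj_def by (intro bounded_linear_intros)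

lemma block_proj_diff: "block_proj n E i (x - y) = block_proj n E i x - block_proj n E i y"
  by (rule linear_diff[OF bounded_linear.linear[OF bounded_linear_block_proj]])

lemma block_proj_zero: "block_proj n E i 0 = 0"
  by (simp add: block_proj_def)

text \<open>All columns are standard basis vectors, and injectivity of the enumeration makes
  distinct index pairs give distinct ones.\<close>

lemma block_partition_inner:
  assumes "block_partition N n E" "i \<in> {1..N}" "l < n i" "j \<in> {1..N}" "m < n j"
  shows "E i l \<bullet> E j m = (if i = j \<and> l = m then 1 else 0)"
proof -
  let ?S = "SIGMA i:{1..N}. {..<n i}"
  have bij: "bij_betw (\<lambda>(i, l). E i l) ?S (range (\<lambda>j. axis j 1))"
    using assms(1) by (simp add: block_partition_def)
  have mem: "(i, l) \<in> ?S" "(j, m) \<in> ?S" using assms by auto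
  obtain a where a: "E i l = axis a 1" using bij_betwE[OF bij] mem(1) by fastforce
  obtain b where b: "E j m = axis b 1" using bij_betwE[OF bij] mem(2) by fastforce
  have "E i l = E j m \<longleftrightarrow> (i, l) = (j, m)"
    using inj_on_eq_iff[OF bij_betw_imp_inj_on[OF bij] mem] by simp
  thus ?thesis by (auto simp: a b inner_axis_axis axis_eq_axis)
qed

text \<open>The columns enumerate the standard basis exactly once, so the double sum is the basis
  expansion of \<open>x\<close>.\<close>

lemma sum_block_proj:
  fixes E :: "nat \<Rightarrow> nat \<Rightarrow> real ^ 'd"
  assumes "block_partition N n E"
  shows "(\<Sum>i = 1..N. block_proj n E i x) = x"
proof -
  have "(\<Sum>i = 1..N. block_proj n E i x)
      = (\<Sum>p\<in>(SIGMA i:{1..N}. {..<n i}). (\<lambda>b. (b \<bullet> x) *\<^sub>R b) ((\<lambda>(i, l). E i l) p))"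
    unfolding block_proj_def by (subst sum.Sigma) (auto intro: sum.cong)
  also have "\<dots> = (\<Sum>b\<in>range (\<lambda>j. axis j 1). (b \<bullet> x) *\<^sub>R b)"
    using assms unfolding block_partition_def by (rule sum.reindex_bij_betw)
  also have "range (\<lambda>j. axis j 1) = (Basis :: (real ^ 'd) set)"
    by (auto simp: Basis_vec_def)
  also have "(\<Sum>b\<in>Basis. (b \<bullet> x) *\<^sub>R b) = x"
    using euclidean_representation[of x] by (simp add: inner_commute)
  finally show ?thesis .
qed

lemma inner_block_proj_distinct:
  assumes "block_partition N n E" "i \<in> {1..N}" "j \<in> {1..N}" "i \<noteq> j"
  shows "block_proj n E i x \<bullet> block_proj n E j y = 0"
  unfolding block_proj_def inner_sum_left inner_sum_right
  using assms by (intro sum.neutral ballI) (simp add: block_partition_inner)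

lemma norm_block_proj_sq:
  assumes "block_partition N n E" "i \<in> {1..N}"
  shows "(norm (block_proj n E i x))\<^sup>2 = (\<Sum>l<n i. (E i l \<bullet> x)\<^sup>2)"
proof -
  have "(norm (block_proj n E i x))\<^sup>2
      = (\<Sum>l<n i. \<Sum>m<n i. (E i l \<bullet> x) * ((E i m \<bullet> x) * (E i l \<bullet> E i m)))"
    unfolding power2_norm_eq_inner
    by (simp add: block_proj_def inner_sum_left inner_sum_right sum_distrib_left inner_commute
        mult.left_commute)
  also have "\<dots> = (\<Sum>l<n i. \<Sum>m<n i. if l = m then (E i l \<bullet> x)\<^sup>2 else 0)"
    using assms by (intro sum.cong refl) (auto simp: block_partition_inner power2_eq_square)
  finally show ?thesis by simp
qed

lemma Rnorm_block_diff:
  assumes "block_partition N n E" "i \<in> {1..N}"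
  shows "Rnorm (n i) (\<lambda>l. block n E y i l - block n E x i l) = norm (block_proj n E i (y - x))"
proof -
  have "(Rnorm (n i) (\<lambda>l. block n E y i l - block n E x i l))\<^sup>2 = (norm (block_proj n E i (y - x)))\<^sup>2"
    by (simp add: norm_block_proj_sq[OF assms] L2_set_def sum_nonneg block_def inner_diff_right)
  thus ?thesis by (simp add: power2_eq_iff_nonneg L2_set_nonneg)
qed

text \<open>Pythagoras for the mutually orthogonal block components.\<close>

lemma norm_sq_eq_sum_block_proj:
  assumes "block_partition N n E"
  shows "(norm x)\<^sup>2 = (\<Sum>i = 1..N. (norm (block_proj n E i x))\<^sup>2)"
proof -
  have "(norm x)\<^sup>2 = (\<Sum>i = 1..N. block_proj n E i x) \<bullet> (\<Sum>j = 1..N. block_proj n E j x)"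
    by (simp add: sum_block_proj[OF assms] power2_norm_eq_inner)
  also have "\<dots> = (\<Sum>i = 1..N. \<Sum>j = 1..N. block_proj n E i x \<bullet> block_proj n E j x)"
    unfolding inner_sum_left unfolding inner_sum_right by (rule refl)
  also have "\<dots> = (\<Sum>i = 1..N. \<Sum>j = 1..N. if i = j then (norm (block_proj n E i x))\<^sup>2 else 0)"
    using assms
    by (intro sum.cong refl) (auto simp: inner_block_proj_distinct power2_norm_eq_inner)
  finally show ?thesis by simp
qed

lemma norm_block_proj_le:
  assumes "block_partition N n E" "i \<in> {1..N}"
  shows "norm (block_proj n E i x) \<le> norm x"
proof -
  have "(norm (block_proj n E i x))\<^sup>2 \<le> (norm x)\<^sup>2"
    unfolding norm_sq_eq_sum_block_proj[OF assms(1), of x]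
    using assms(2) by (intro member_le_sum) auto
  thus ?thesis by (simp add: power2_le_iff_abs_le)
qed

text \<open>The index type \<open>'d\<close> is nonempty, so there is a basis vector to be
  enumerated. This makes the minimum over the \<open>M i\<close> meaningful.\<close>

lemma block_partition_pos:
  assumes "block_partition N n E"
  shows "N \<ge> 1"
proof (rule ccontr)
  assume "\<not> N \<ge> 1"
  with assms show False by (auto simp: block_partition_def bij_betw_def)
qed

subsection \<open>One sweep of the algorithm\<close>

text \<open>Membership in the domain is assumed for the old iterate \<open>x\<close> only;
  \<open>dom'\<close> derives it for \<open>x'\<close>, which later closes an induction over the
  sweeps.\<close>

locale rccm_sweep =
  fixes N :: nat and n :: "nat \<Rightarrow> nat" and E :: "nat \<Rightarrow> nat \<Rightarrow> real ^ 'd"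
    and f :: "real ^ 'd \<Rightarrow> real" and g :: "real ^ 'd \<Rightarrow> ereal"
    and gi :: "nat \<Rightarrow> (nat \<Rightarrow> real) \<Rightarrow> ereal"
    and M :: "nat \<Rightarrow> real" and x x' :: "real ^ 'd"
  assumes blocks: "block_partition N n E"
    and g_separable: "separable N n E g gi"
    and M_pos: "i \<in> {1..N} \<Longrightarrow> M i > 0"
    and dom: "x \<in> effective_domain g"
    and arg_min: "i \<in> {1..N} \<Longrightarrow>
      is_arg_min (rccm_objective N n E f gi M x x' i) (\<lambda>z. z \<in> Rpow (n i)) (block n E x' i)"
begin

abbreviation P :: "nat \<Rightarrow> real ^ 'd \<Rightarrow> real ^ 'd" where
  "P \<equiv> block_proj n E"

text \<open>\<open>w i\<close> is the iterate after the \<open>i\<close>-th block update.\<close>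

definition w :: "nat \<Rightarrow> real ^ 'd" where
  "w i = (\<Sum>j = 1..N. P j (if j \<le> i then x' else x))"

text \<open>Since \<open>real_of_ereal\<close> sends infinite values to 0, \<open>G\<close> is
  faithful only where \<open>gi i\<close> is finite, in particular on the effective domain.\<close>

definition G :: "nat \<Rightarrow> real ^ 'd \<Rightarrow> real" where
  "G i y = real_of_ereal (gi i (block n E y i))"

lemma w_0: "w 0 = x"
  using sum_block_proj[OF blocks, of x] by (simp add: w_def)

lemma w_N: "w N = x'"
proof -
  have "w N = (\<Sum>j = 1..N. P j x')"
    unfolding w_def by (intro sum.cong) auto
  thus ?thesis by (simp add: sum_block_proj[OF blocks])
qed

text \<open>The i-th block of \<open>w i\<close> is already that of \<open>x'\<close>, so replacing
  it by that of \<open>y\<close> is a shift by the projected difference. The block objective thus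
  becomes a function of \<open>y\<close> on the whole space.\<close>

lemma hybrid_eq:
  assumes "i \<in> {1..N}"
  shows "(\<Sum>j = 1..N. P j (if j < i then x' else if j = i then y else x)) = w i + P i (y - x')"
proof -
  have "(\<Sum>j = 1..N. P j (if j < i then x' else if j = i then y else x)) - w i
      = (\<Sum>j = 1..N. if j = i then P i (y - x') else 0)"
    unfolding w_def sum_subtractf[symmetric]
    by (intro sum.cong) (auto simp: block_proj_diff)
  also have "\<dots> = P i (y - x')" using assms by simp
  finally show ?thesis by (simp add: algebra_simps)
qed

lemma w_pred:
  assumes "i \<in> {1..N}"
  shows "w i + P i (x - x') = w (i - 1)"
  using assms by (subst hybrid_eq[OF assms, symmetric], unfold w_def, intro sum.cong) auto

lemma objective_eq:
  assumes "i \<in> {1..N}"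
  shows "rccm_objective N n E f gi M x x' i (block n E y i)
    = ereal (f (w i + P i (y - x'))) + gi i (block n E y i)
      + ereal (M i / 2 * (norm (P i (y - x)))\<^sup>2)"
proof -
  have "(\<lambda>j. if j < i then block n E x' j else if j = i then block n E y i else block n E x j)
      = (\<lambda>j. block n E (if j < i then x' else if j = i then y else x) j)"
    by auto
  thus ?thesis
    by (simp add: rccm_objective_def assemble_block hybrid_eq[OF assms]
        Rnorm_block_diff[OF blocks assms])
qed

lemma objective_le:
  assumes "i \<in> {1..N}"
  shows "ereal (f (w i)) + gi i (block n E x' i) + ereal (M i / 2 * (norm (P i (x' - x)))\<^sup>2)
    \<le> ereal (f (w i + P i (y - x'))) + gi i (block n E y i)
      + ereal (M i / 2 * (norm (P i (y - x)))\<^sup>2)"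
proof -
  have "rccm_objective N n E f gi M x x' i (block n E x' i)
      \<le> rccm_objective N n E f gi M x x' i (block n E y i)"
    using arg_min[OF assms] block_mem_Rpow[of n E y i] unfolding is_arg_min_linorder by blast
  thus ?thesis by (simp only: objective_eq[OF assms]) (simp add: block_proj_zero)
qed

lemma gi_not_MInf:
  assumes "i \<in> {1..N}"
  shows "gi i (block n E y i) \<noteq> -\<infinity>"
  using g_separable assms block_mem_Rpow unfolding separable_def by blast

lemma mem_dom_iff: "y \<in> effective_domain g \<longleftrightarrow> (\<forall>i\<in>{1..N}. \<bar>gi i (block n E y i)\<bar> \<noteq> \<infinity>)"
proof -
  have fin_iff: "e \<noteq> \<infinity> \<longleftrightarrow> \<bar>e\<bar> \<noteq> \<infinity>" if "e \<noteq> -\<infinity>" for e :: ereal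
    using that by (cases e) auto
  have "y \<in> effective_domain g \<longleftrightarrow> g y \<noteq> \<infinity>"
    by (simp add: effective_domain_def)
  also have "g y = (\<Sum>i = 1..N. gi i (block n E y i))"
    using g_separable by (simp add: separable_def)
  also have "\<dots> \<noteq> \<infinity> \<longleftrightarrow> (\<forall>i\<in>{1..N}. gi i (block n E y i) \<noteq> \<infinity>)"
    by (auto simp: sum_Pinfty)
  also have "\<dots> \<longleftrightarrow> (\<forall>i\<in>{1..N}. \<bar>gi i (block n E y i)\<bar> \<noteq> \<infinity>)"
    using gi_not_MInf by (intro ball_cong refl fin_iff)
  finally show ?thesis .
qed

lemma g_eq_sum_G:
  assumes "y \<in> effective_domain g"
  shows "g y = ereal (\<Sum>i = 1..N. G i y)"
proof -
  have "g y = (\<Sum>i = 1..N. gi i (block n E y i))"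
    using g_separable by (simp add: separable_def)
  also have "\<dots> = (\<Sum>i = 1..N. ereal (G i y))"
    using assms unfolding mem_dom_iff G_def by (intro sum.cong) (auto simp: ereal_real)
  finally show ?thesis by (simp add: sum_ereal)
qed

text \<open>Keeping the old block has a finite objective value, so the minimizing block has one
  too.\<close>

lemma dom': "x' \<in> effective_domain g"
  unfolding mem_dom_iff
proof
  fix i assume i: "i \<in> {1..N}"
  have "\<bar>gi i (block n E x i)\<bar> \<noteq> \<infinity>" using dom i by (simp add: mem_dom_iff)
  thus "\<bar>gi i (block n E x' i)\<bar> \<noteq> \<infinity>"
    using objective_le[OF i, of x] gi_not_MInf[OF i, of x']
    by (cases "gi i (block n E x i)"; cases "gi i (block n E x' i)") auto
qed

text \<open>The source of both main estimates: \<open>y = x\<close> gives the decrease of the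
  objective, arbitrary \<open>y\<close> the smooth minorant.\<close>

lemma block_le:
  assumes "i \<in> {1..N}" "y \<in> effective_domain g"
  shows "f (w i) + G i x' + M i / 2 * (norm (P i (x' - x)))\<^sup>2
    \<le> f (w i + P i (y - x')) + G i y + M i / 2 * (norm (P i (y - x)))\<^sup>2"
proof -
  have "\<bar>gi i (block n E x' i)\<bar> \<noteq> \<infinity>" "\<bar>gi i (block n E y i)\<bar> \<noteq> \<infinity>"
    using assms dom' by (auto simp: mem_dom_iff)
  thus ?thesis using objective_le[OF assms(1), of y] unfolding G_def
    by (cases "gi i (block n E x' i)"; cases "gi i (block n E y i)") auto
qed

text \<open>By \<open>w_pred\<close>, taking \<open>y = x\<close> in \<open>block_le\<close>
  compares \<open>w i\<close> with \<open>w (i - 1)\<close>. Over the blocks the values of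
  \<open>f\<close> telescope, and the proximal terms add up by Pythagoras.\<close>

lemma sufficient_decrease:
  "f x' + real_of_ereal (g x') + Min (M ` {1..N}) / 2 * (norm (x' - x))\<^sup>2
    \<le> f x + real_of_ereal (g x)"
proof -
  have "(\<Sum>i = 1..N. f (w i) - f (w (i - 1))) = f x' - f x"
    using sum_telescope''[of 0 N "\<lambda>i. f (w i)"] by (simp add: w_0 w_N One_nat_def)
  moreover have "(\<Sum>i = 1..N. f (w i) - f (w (i - 1))) + (\<Sum>i = 1..N. G i x')
      + (\<Sum>i = 1..N. Min (M ` {1..N}) / 2 * (norm (P i (x' - x)))\<^sup>2) \<le> (\<Sum>i = 1..N. G i x)"
    unfolding sum.distrib[symmetric]
  proof (rule sum_mono)
    fix i assume i: "i \<in> {1..N}"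
    have "Min (M ` {1..N}) / 2 * (norm (P i (x' - x)))\<^sup>2 \<le> M i / 2 * (norm (P i (x' - x)))\<^sup>2"
      using i by (intro mult_right_mono divide_right_mono) auto
    with block_le[OF i dom] w_pred[OF i]
    show "f (w i) - f (w (i - 1)) + G i x' + Min (M ` {1..N}) / 2 * (norm (P i (x' - x)))\<^sup>2 \<le> G i x"
      by (simp add: block_proj_zero)
  qed
  ultimately show ?thesis
    by (simp add: g_eq_sum_G dom dom' norm_sq_eq_sum_block_proj[OF blocks, of "x' - x"]
        sum_distrib_left)
qed

text \<open>Triangle inequality over the blocks \<open>j > i\<close> not yet updated, each bounded
  by the whole step; this is the factor \<open>N\<close> inside the final constant.\<close>

lemma norm_w_diff_le: "norm (x' - w i) \<le> real N * norm (x' - x)"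
proof -
  have "x' - w i = (\<Sum>j = 1..N. P j (if j \<le> i then 0 else x' - x))"
    by (subst sum_block_proj[OF blocks, of x', symmetric])
      (auto simp: w_def block_proj_diff block_proj_zero simp flip: sum_subtractf intro!: sum.cong)
  also have "norm \<dots> \<le> (\<Sum>j = 1..N. norm (x' - x))"
    by (intro sum_norm_le order_trans[OF norm_block_proj_le[OF blocks]]) auto
  finally show ?thesis by simp
qed

lemma norm_w_le:
  assumes "norm x \<le> B" "norm x' \<le> B"
  shows "norm (w i) \<le> real N * B"
proof -
  have "norm (w i) \<le> (\<Sum>j = 1..N. B)" unfolding w_def
    using assms by (intro sum_norm_le order_trans[OF norm_block_proj_le[OF blocks]]) auto
  thus ?thesis by simp
qed

text \<open>
  Optimality in each block bounds \<open>g\<^sub>i\<close> below by a smooth function touching it at \<open>x'\<close>. Adding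
  these minorants to \<open>f\<close> gives a smooth minorant of \<open>F\<close>, whose gradient is the subgradient sought.
\<close>

lemma small_subgradient:
  fixes f' :: "real ^ 'd \<Rightarrow> (real ^ 'd) \<Rightarrow>\<^sub>L real"
  assumes f': "\<And>y. (f has_derivative blinfun_apply (f' y)) (at y)"
    and lip: "\<And>i. i \<in> {1..N} \<Longrightarrow> norm (f' x' - f' (w i)) \<le> L * norm (x' - w i)"
    and L: "L \<ge> 0"
  shows "\<exists>s\<in>frechet_subdiff (\<lambda>y. ereal (f y) + g y) x'.
    norm s \<le> (\<Sum>i = 1..N. L * real N + M i) * norm (x' - x)"
proof -
  \<comment> \<open>The subtracted terms are the smooth parts of the block objectives. Summing
    \<open>block_le\<close> over the blocks shows that the change of \<open>g\<close> from
    \<open>x'\<close> to \<open>y\<close> is at least minus the change of this sum.\<close>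
  define \<phi> where "\<phi> y = f y - (\<Sum>i = 1..N. f (w i + P i (y - x')) + M i / 2 * (norm (P i (y - x)))\<^sup>2)"
    for y
  \<comment> \<open>The contribution of block i to the derivative of \<open>\<phi>\<close> at
    \<open>x'\<close> in direction \<open>h\<close>; their sum \<open>A\<close> is the full
    derivative.\<close>
  define D where "D i h = (f' x' - f' (w i)) (P i h) - M i * (P i (x' - x) \<bullet> P i h)" for i h
  define A where "A h = (\<Sum>i = 1..N. D i h)" for h
  have blP: "bounded_linear (P i)" for i by (rule bounded_linear_block_proj)
  have dP: "(P i has_derivative P i) F" for i F
    using bounded_linear_imp_has_derivative[OF blP] .
  have blA: "bounded_linear A"
    unfolding A_def D_def
    by (intro bounded_linear_intros bounded_linear_compose[OF blinfun.bounded_linear_right blP]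
        bounded_linear_compose[OF bounded_linear_inner_right blP]
        bounded_linear_const_mult)
  have D_le: "\<bar>D i h\<bar> \<le> (L * real N + M i) * norm (x' - x) * norm h" if i: "i \<in> {1..N}" for i h
  proof -
    have Ph: "norm (P i h) \<le> norm h" by (rule norm_block_proj_le[OF blocks i])
    have "\<bar>(f' x' - f' (w i)) (P i h)\<bar> \<le> norm (f' x' - f' (w i)) * norm (P i h)"
      using norm_blinfun[of "f' x' - f' (w i)" "P i h"] by simp
    also have "\<dots> \<le> (L * (real N * norm (x' - x))) * norm h"
      using norm_w_diff_le[of i] L
      by (intro mult_mono Ph order_trans[OF lip[OF i]] mult_left_mono) auto
    finally have 1: "\<bar>(f' x' - f' (w i)) (P i h)\<bar> \<le> (L * (real N * norm (x' - x))) * norm h" .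
    have "\<bar>P i (x' - x) \<bullet> P i h\<bar> \<le> norm (P i (x' - x)) * norm (P i h)"
      by (rule Cauchy_Schwarz_ineq2)
    also have "\<dots> \<le> norm (x' - x) * norm h"
      by (intro mult_mono Ph norm_block_proj_le[OF blocks i]) auto
    finally have "M i * \<bar>P i (x' - x) \<bullet> P i h\<bar> \<le> M i * (norm (x' - x) * norm h)"
      using M_pos[OF i] by (intro mult_left_mono) auto
    hence 2: "\<bar>M i * (P i (x' - x) \<bullet> P i h)\<bar> \<le> M i * (norm (x' - x) * norm h)"
      using M_pos[OF i] by (simp add: abs_mult)
    from 1 2 show ?thesis unfolding D_def by (simp add: algebra_simps)
  qed
  have A_le: "norm (A h) \<le> norm h * ((\<Sum>i = 1..N. L * real N + M i) * norm (x' - x))" for h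
  proof -
    have "norm (A h) \<le> (\<Sum>i = 1..N. (L * real N + M i) * norm (x' - x) * norm h)"
      unfolding A_def using D_le by (intro sum_norm_le) auto
    also have "\<dots> = (\<Sum>i = 1..N. L * real N + M i) * norm (x' - x) * norm h"
      by (simp only: sum_distrib_right)
    finally show ?thesis by (simp only: mult_ac)
  qed
  obtain s where s: "\<And>h. A h = s \<bullet> h" "norm s \<le> norm (Blinfun A)"
    using riesz_euclidean[of "Blinfun A"] bounded_linear_Blinfun_apply[OF blA] by metis
  have "norm (Blinfun A) \<le> (\<Sum>i = 1..N. L * real N + M i) * norm (x' - x)"
  proof (rule norm_blinfun_bound)
    show "0 \<le> (\<Sum>i = 1..N. L * real N + M i) * norm (x' - x)"
      using M_pos L by (intro mult_nonneg_nonneg sum_nonneg add_nonneg_nonneg) (auto intro: less_imp_le)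
    show "norm (Blinfun A h) \<le> (\<Sum>i = 1..N. L * real N + M i) * norm (x' - x) * norm h" for h
      using A_le[of h] by (simp only: bounded_linear_Blinfun_apply[OF blA] mult_ac)
  qed
  with s(2) have norm_s: "norm s \<le> (\<Sum>i = 1..N. L * real N + M i) * norm (x' - x)"
    by linarith
  have f_der: "((\<lambda>y. f (w i + P i (y - x'))) has_derivative (\<lambda>h. f' (w i) (P i h))) (at x')" for i
  proof -
    have "((\<lambda>y. w i + P i (y - x')) has_derivative P i) (at x')"
      by (auto intro!: derivative_eq_intros bounded_linear.has_derivative[OF blP])
    from has_derivative_compose[OF this, of f "f' (w i)"] f'[of "w i"] show ?thesis
      by (simp add: block_proj_zero)
  qed
  have n_der: "((\<lambda>y. M i / 2 * (norm (P i (y - x)))\<^sup>2) has_derivative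
      (\<lambda>h. M i * (P i (x' - x) \<bullet> P i h))) (at x')" for i
    unfolding power2_norm_eq_inner
    by (auto intro!: derivative_eq_intros bounded_linear.has_derivative[OF blP]
        simp: inner_commute)
  \<comment> \<open>Distributing the derivative of \<open>f\<close> over the blocks pairs each piece
    with the one at \<open>w i\<close>, leaving the differences that the Lipschitz bound
    controls.\<close>
  have f'_split: "f' x' h = (\<Sum>i = 1..N. f' x' (P i h))" for h
    by (simp only: sum_block_proj[OF blocks] blinfun.sum_right[symmetric])
  have "(\<phi> has_derivative (\<lambda>h. f' x' h -
      (\<Sum>i = 1..N. f' (w i) (P i h) + M i * (P i (x' - x) \<bullet> P i h)))) (at x')"
    unfolding \<phi>_def by (intro has_derivative_diff has_derivative_sum has_derivative_add f' f_der n_der)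
  moreover have "(\<lambda>h. f' x' h - (\<Sum>i = 1..N. f' (w i) (P i h) + M i * (P i (x' - x) \<bullet> P i h))) = A"
    by (rule ext, subst f'_split)
      (simp add: A_def D_def blinfun.diff_left diff_diff_eq flip: sum_subtractf)
  moreover have "A = (\<lambda>h. s \<bullet> h)" using s by auto
  ultimately have der: "(\<phi> has_derivative (\<lambda>h. s \<bullet> h)) (at x')" by simp
  have "s \<in> frechet_subdiff (\<lambda>y. ereal (f y) + g y) x'"
  proof (rule frechet_subdiff_of_minorant[OF _ der])
    show "\<bar>ereal (f x') + g x'\<bar> \<noteq> \<infinity>" by (simp add: g_eq_sum_G dom')
    fix y
    show "ereal (f x') + g x' + ereal (\<phi> y - \<phi> x') \<le> ereal (f y) + g y"
    proof (cases "y \<in> effective_domain g")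
      case False
      thus ?thesis by (simp add: effective_domain_def)
    next
      case True
      have "(\<Sum>i = 1..N. f (w i) + G i x' + M i / 2 * (norm (P i (x' - x)))\<^sup>2)
        \<le> (\<Sum>i = 1..N. f (w i + P i (y - x')) + G i y + M i / 2 * (norm (P i (y - x)))\<^sup>2)"
        using block_le True by (intro sum_mono) auto
      thus ?thesis
        by (simp add: \<phi>_def g_eq_sum_G True dom' sum.distrib block_proj_zero)
    qed
  qed
  with norm_s show ?thesis by blast
qed

end

section \<open>Uniform constant and rate along the whole sequence\<close>

theorem theorem1:
  fixes N :: nat and n :: "nat \<Rightarrow> nat" and E :: "nat \<Rightarrow> nat \<Rightarrow> real ^ 'd"
    and f :: "real ^ 'd \<Rightarrow> real" and g F :: "real ^ 'd \<Rightarrow> ereal"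
    and gi :: "nat \<Rightarrow> (nat \<Rightarrow> real) \<Rightarrow> ereal"
    and M :: "nat \<Rightarrow> real" and x :: "nat \<Rightarrow> real ^ 'd"
    and Fstar :: ereal and Mmin :: real
  assumes blocks: "block_partition N n E"
    and F_def: "F = (\<lambda>y. ereal (f y) + g y)"
    and f_C2: "twice_continuously_differentiable f"
    and g_proper: "proper_fun g"
    and g_lsc: "lsc_fun g"
    and g_separable: "separable N n E g gi"
    and bounded_below: "block_problems_bounded_below N n E f gi"
    and solution: "\<exists>y. \<forall>z. F y \<le> F z"
    and Fstar_def: "Fstar = (INF y. F y)"
    and M_pos: "\<forall>i\<in>{1..N}. M i > 0"
    and Mmin_def: "Mmin = Min (M ` {1..N})"
    and rccm: "rccm_sequence N n E f g gi M x"
    and x_bounded: "bounded (range x)"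
  shows "\<exists>C>0.
    (\<forall>k. (\<exists>s. is_arg_min norm (\<lambda>s. s \<in> limiting_subdiff F (x (Suc k))) s) \<and>
         (INF s\<in>limiting_subdiff F (x (Suc k)). norm s) \<le> C * norm (x (Suc k) - x k)) \<and>
    (\<forall>K. ereal (Min ((\<lambda>k. INF s\<in>limiting_subdiff F (x (Suc k)). (norm s)\<^sup>2) ` {0..K}))
          \<le> ereal (2 * C\<^sup>2) * (F (x 0) - Fstar) / ereal (Mmin * (real K + 1)))"
proof -
  obtain f' :: "real ^ 'd \<Rightarrow> (real ^ 'd) \<Rightarrow>\<^sub>L real" and f''
    where f': "\<And>y. (f has_derivative blinfun_apply (f' y)) (at y)"
      and f'': "\<And>y. (f' has_derivative blinfun_apply (f'' y)) (at y)" "continuous_on UNIV f''"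
    using f_C2 unfolding twice_continuously_differentiable_def by blast
  have N: "N \<ge> 1" by (rule block_partition_pos[OF blocks])
  have sweep_if: "rccm_sweep N n E f g gi M (x k) (x (Suc k))" if "x k \<in> effective_domain g" for k
    using that blocks g_separable M_pos rccm
    by unfold_locales (auto simp: rccm_sequence_def)
  have dom: "x k \<in> effective_domain g" for k
  proof (induction k)
    case 0
    show ?case using rccm by (simp add: rccm_sequence_def)
  next
    case (Suc k)
    show ?case by (rule rccm_sweep.dom'[OF sweep_if[OF Suc]])
  qed
  note sweep = sweep_if[OF dom]
  obtain B where B: "\<And>k. norm (x k) \<le> B"
    using x_bounded unfolding bounded_iff by auto
  have "B \<ge> 0" using B[of 0] norm_ge_zero order_trans by blast
  \<comment> \<open>The radius \<open>real N * B\<close> covers the iterates as well as all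
    intermediate points of all sweeps, so one Lipschitz constant \<open>L\<close> serves every
    \<open>k\<close>.\<close>
  have B_le: "B \<le> real N * B" using \<open>B \<ge> 0\<close> N by (simp add: mult_le_cancel_right1)
  obtain L where L: "L \<ge> 0"
    "\<And>u v. \<lbrakk>norm u \<le> real N * B; norm v \<le> real N * B\<rbrakk> \<Longrightarrow> norm (f' u - f' v) \<le> L * norm (u - v)"
    using C2_derivative_lipschitz_on_cball[OF f'', of "real N * B"] by blast
  define C where "C = (\<Sum>i = 1..N. L * real N + M i)"
  have "C > 0" unfolding C_def
    using N M_pos L(1) by (intro sum_pos) (auto intro: add_nonneg_pos)
  have Mmin: "Mmin > 0" using M_pos N by (auto simp: Mmin_def)
  have "\<exists>s\<in>limiting_subdiff F (x (Suc k)). norm s \<le> C * norm (x (Suc k) - x k)" for k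
  proof -
    interpret rccm_sweep N n E f g gi M "x k" "x (Suc k)" by (rule sweep)
    have "norm (f' (x (Suc k)) - f' (w i)) \<le> L * norm (x (Suc k) - w i)" for i
      using B B_le norm_w_le by (intro L(2)) (blast intro: order_trans)+
    from small_subgradient[OF f' this L(1)] show ?thesis
      using frechet_subdiff_subset_limiting unfolding F_def C_def by blast
  qed
  then obtain s where s: "\<And>k. s k \<in> limiting_subdiff F (x (Suc k))"
    and s_le: "\<And>k. norm (s k) \<le> C * norm (x (Suc k) - x k)"
    by metis
  define a where "a k = f (x k) + real_of_ereal (g (x k))" for k
  have F_x: "F (x k) = ereal (a k)" for k
  proof -
    interpret rccm_sweep N n E f g gi M "x k" "x (Suc k)" by (rule sweep)
    show ?thesis by (simp add: a_def F_def g_eq_sum_G dom)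
  qed
  have decrease: "a (Suc k) + Mmin / 2 * (norm (x (Suc k) - x k))\<^sup>2 \<le> a k" for k
    using rccm_sweep.sufficient_decrease[OF sweep] by (simp add: a_def Mmin_def)
  \<comment> \<open>The optimal value is attained. It is not \<open>-\<infinity>\<close> because
    \<open>g\<close> is proper, and not \<open>\<infinity>\<close> because \<open>F (x 0)\<close> is
    finite; the rate thus reduces to an inequality between reals.\<close>
  obtain b where b: "Fstar = ereal b"
  proof -
    obtain y where y: "\<And>z. F y \<le> F z" using solution by blast
    have "Fstar = F y" unfolding Fstar_def
      by (intro antisym INF_lower INF_greatest) (auto simp: y)
    moreover have "F y \<noteq> -\<infinity>" using g_proper by (simp add: F_def proper_fun_def)
    moreover have "F y \<noteq> \<infinity>" using y[of "x 0"] F_x[of 0] by auto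
    ultimately show thesis using that by (cases "F y") auto
  qed
  have b_le: "b \<le> a k" for k
    using INF_lower[of "x k" UNIV F] by (simp add: b F_x flip: Fstar_def)
  have rate: "ereal (Min ((\<lambda>k. INF s\<in>limiting_subdiff F (x (Suc k)). (norm s)\<^sup>2) ` {0..K}))
      \<le> ereal (2 * C\<^sup>2) * (F (x 0) - Fstar) / ereal (Mmin * (real K + 1))" for K
  proof -
    let ?m = "\<lambda>k. INF s\<in>limiting_subdiff F (x (Suc k)). (norm s)\<^sup>2"
    have step: "?m k \<le> 2 * C\<^sup>2 / Mmin * (a k - a (Suc k))" for k
    proof -
      have "?m k \<le> (norm (s k))\<^sup>2"
        using s by (intro cINF_lower bdd_belowI2[of _ 0]) auto
      also have "\<dots> \<le> (C * norm (x (Suc k) - x k))\<^sup>2"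
        using s_le by (intro power_mono) auto
      \<comment> \<open>Inserting \<open>Mmin / 2\<close> produces exactly the quantity bounded by
        the decrease of \<open>a\<close>.\<close>
      also have "\<dots> = 2 * C\<^sup>2 / Mmin * (Mmin / 2 * (norm (x (Suc k) - x k))\<^sup>2)"
        using Mmin by (simp add: power_mult_distrib)
      also have "\<dots> \<le> 2 * C\<^sup>2 / Mmin * (a k - a (Suc k))"
        using decrease[of k] Mmin by (intro mult_left_mono) auto
      finally show ?thesis .
    qed
    \<comment> \<open>The minimum is at most each of the \<open>K + 1\<close> terms, whose bounds
      telescope to \<open>a 0 - a (Suc K)\<close>.\<close>
    have "(real K + 1) * Min (?m ` {0..K}) = (\<Sum>k = 0..K. Min (?m ` {0..K}))" by simp
    also have "\<dots> \<le> (\<Sum>k = 0..K. 2 * C\<^sup>2 / Mmin * (a k - a (Suc k)))"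
      by (intro sum_mono order_trans[OF Min_le step]) auto
    also have "\<dots> = 2 * C\<^sup>2 / Mmin * (a 0 - a (Suc K))"
      unfolding sum_distrib_left[symmetric]
      using sum_telescope[of a K] by (simp add: atMost_atLeast0)
    also have "\<dots> \<le> 2 * C\<^sup>2 / Mmin * (a 0 - b)"
      using b_le Mmin by (intro mult_left_mono) auto
    finally have "Min (?m ` {0..K}) \<le> 2 * C\<^sup>2 * (a 0 - b) / (Mmin * (real K + 1))"
      using Mmin by (simp add: pos_le_divide_eq mult_ac)
    thus ?thesis using Mmin by (simp add: F_x b)
  qed
  have "(INF s\<in>limiting_subdiff F (x (Suc k)). norm s) \<le> C * norm (x (Suc k) - x k)" for k
    using s s_le by (intro cINF_lower2[of _ _ "s k"] bdd_belowI2[of _ 0]) auto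
  moreover have "\<exists>s. is_arg_min norm (\<lambda>s. s \<in> limiting_subdiff F (x (Suc k))) s" for k
    using s by (intro limiting_subdiff_minimal_norm) auto
  ultimately show ?thesis using \<open>C > 0\<close> rate by blast
qed

end
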